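(* Let $$A=\begin{bmatrix} A_{ff} & A_{fc} \\ A_{cf} & A_{cc} \end{bmatrix}\in\mathbb{R}^{n\times n}$$ be symmetric positive definite, and let $$R=\begin{bmatrix} 0 & I \end{bmatrix},\qquad S=\begin{bmatrix} I \\ 0 \end{bmatrix},\qquad P_\star=\begin{bmatrix} W_\star \\ I \end{bmatrix},\qquad W_\star=-A_{ff}^{-1}A_{fc}.$$ Then $$I-\Pi_A(P_\star)=I-P_\star(P_\star^TAP_\star)^{-1}P_\star^TA=S(S^TAS)^{-1}S^TA=\begin{pmatrix} I & -W_\star \\ 0 & 0 \end{pmatrix}.$$ Moreover, let $M\in\mathbb{R}^{n\times n}$ be a smoother such that $M+M^T-A$ is symmetric positive definite, and let $M_{ff}=S^TMS$. If $$\rho_S=\| I-M_{ff}^{-1}A_{ff}\|_{A_{ff}}\le\delta<1,$$ then $$\kappa(A_{ff})\le\kappa(M_{ff})\,\frac{1+\delta}{1-\delta}.$$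
   Context: All block partitions conform to a splitting of the unknowns into $F$ (first block) and $C$ (second block). $\Pi_A(P)=P(P^TAP)^{-1}P^TA$ is the $A$-orthogonal projection onto $\operatorname{range}(P)$. $\|\cdot\|_{A_{ff}}$ is the operator norm induced by $\|\mathbf{v}\|_{A_{ff}}^2=\mathbf{v}^TA_{ff}\mathbf{v}$, and $\kappa(\cdot)$ is the (spectral) condition number of a matrix. *)

theory Defs
  imports "HOL-Analysis.Analysis"
begin

(* Block matrices are indexed by sum types: an index is Inl i for the first block,
   Inr j for the second, so the unknowns of the system form the type 'f + 'c. *)

definition row_block :: "'a^'m^'r \<Rightarrow> 'a^'n^'r \<Rightarrow> 'a^('m + 'n)^'r" where
  "row_block X Y = (\<chi> i j. case j of Inl k \<Rightarrow> X $ i $ k | Inr k \<Rightarrow> Y $ i $ k)"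

definition col_block :: "'a^'m^'r \<Rightarrow> 'a^'m^'s \<Rightarrow> 'a^'m^('r + 's)" where
  "col_block X Y = (\<chi> i. case i of Inl k \<Rightarrow> X $ k | Inr k \<Rightarrow> Y $ k)"

definition block_matrix ::
  "'a^'m^'r \<Rightarrow> 'a^'n^'r \<Rightarrow> 'a^'m^'s \<Rightarrow> 'a^'n^'s \<Rightarrow> 'a^('m + 'n)^('r + 's)" where
  "block_matrix X11 X12 X21 X22 = col_block (row_block X11 X12) (row_block X21 X22)"

definition sym_pos_def :: "real^'n^'n \<Rightarrow> bool" where
  "sym_pos_def A \<longleftrightarrow> transpose A = A \<and> (\<forall>v. v \<noteq> 0 \<longrightarrow> 0 < v \<bullet> (A *v v))"

(* The A-orthogonal projection onto the range of P, for P of full column rank. *)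
definition A_projection :: "real^'n^'n \<Rightarrow> real^'m^'n \<Rightarrow> real^'n^'n" where
  "A_projection A P = P ** matrix_inv (transpose P ** A ** P) ** transpose P ** A"

definition energy_norm :: "real^'n^'n \<Rightarrow> real^'n \<Rightarrow> real" where
  "energy_norm A v = sqrt (v \<bullet> (A *v v))"

(* As in the library's onorm, v = 0 is included in the supremum; it contributes 0 / 0 = 0. *)
definition energy_onorm :: "real^'n^'n \<Rightarrow> real^'n^'n \<Rightarrow> real" where
  "energy_onorm A B = (SUP v. energy_norm A (B *v v) / energy_norm A v)"

(* Condition number in the spectral norm (operator norm for the Euclidean norm). It is
   applied to nonsymmetric matrices too; meaningful for invertible ones only. *)
definition cond_number :: "real^'n^'n \<Rightarrow> real" where
  "cond_number B = onorm ((*v) B) * onorm ((*v) (matrix_inv B))"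

end

theory Submission
  imports Defs
begin

text \<open>
  The two projections are computed explicitly.  The choice of \<open>W\<close> makes the first block row of
  \<open>A P\<close> vanish, so \<open>A P\<close> has second block \<open>\<Sigma> = P\<^sup>T A P\<close> (the Schur complement) and, by symmetry,
  \<open>P\<^sup>T A = [0  \<Sigma>]\<close>.  Cancelling \<open>\<Sigma>\<close> leaves \<open>P [0  I]\<close> for the projection onto the range of \<open>P\<close>; in
  the same way \<open>S\<^sup>T A = [A\<^sub>f\<^sub>f  A\<^sub>f\<^sub>c]\<close> leaves \<open>S [I  -W]\<close>.

  For the condition number, write \<open>K = A\<^sub>f\<^sub>f\<close> and \<open>M = M\<^sub>f\<^sub>f\<close>.  Positivity of \<open>M + M\<^sup>T - K\<close> makes
  \<open>M\<close> invertible (\<open>smoother_invertible\<close>), although \<open>M\<close> need not be symmetric.  If \<open>M v = K w\<close>, then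
  \<open>(I - M\<^sup>-\<^sup>1 K) w = w - v\<close>, so the hypothesis says that \<open>w - v\<close> is at most \<open>\<delta>\<close> times as
  long as \<open>w\<close> in the energy norm.  In the \<open>K\<close>-inner product this confines \<open>v\<close> to a ball around
  \<open>w\<close>, and elementary geometry gives two comparisons of quadratic forms:
  \<open>v\<^sup>T K v \<le> (1 + \<delta>) v\<^sup>T M v\<close> (\<open>smoother_lower_bound\<close>) and
  \<open>(1 - \<delta>) y\<^sup>T K\<^sup>-\<^sup>1 y \<le> y\<^sup>T M\<^sup>-\<^sup>1 y\<close> (\<open>smoother_inverse_bound\<close>).  The right-hand sides are
  bounded by the spectral norms of \<open>M\<close> and \<open>M\<^sup>-\<^sup>1\<close>.  Since \<open>K\<close> and \<open>K\<^sup>-\<^sup>1\<close> are symmetric positive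
  definite, bounds on their quadratic forms are bounds on their spectral norms
  (\<open>sym_pos_def_onorm_le\<close>), and the product of the two estimates is the claim.
\<close>

section \<open>Algebra of block matrices\<close>

lemma sum_UNIV_sum:
  fixes g :: "'a::finite + 'b::finite \<Rightarrow> 'c::comm_monoid_add"
  shows "sum g UNIV = (\<Sum>k\<in>UNIV. g (Inl k)) + (\<Sum>k\<in>UNIV. g (Inr k))"
  by (simp add: sum.Plus flip: UNIV_Plus_UNIV)

lemma col_block_mult:
  "col_block X Y ** Z = col_block (X ** Z) (Y ** Z)"
  by (auto simp: vec_eq_iff col_block_def matrix_matrix_mult_def split: sum.split)

lemma mult_row_block:
  "Z ** row_block X Y = row_block (Z ** X) (Z ** Y)"
  by (auto simp: vec_eq_iff row_block_def matrix_matrix_mult_def split: sum.split)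

lemma row_block_mult_col_block:
  fixes X :: "'a::semiring_1^'m::finite^'r" and Y :: "'a^'n::finite^'r"
  shows "row_block X Y ** col_block U V = X ** U + Y ** V"
  by (simp add: vec_eq_iff row_block_def col_block_def matrix_matrix_mult_def sum_UNIV_sum)

lemma transpose_col_block:
  "transpose (col_block X Y) = row_block (transpose X) (transpose Y)"
  by (auto simp: vec_eq_iff row_block_def col_block_def transpose_def split: sum.split)

lemma row_block_col_block:
  "row_block (col_block X11 X21) (col_block X12 X22) = block_matrix X11 X12 X21 X22"
  by (auto simp: vec_eq_iff row_block_def col_block_def block_matrix_def split: sum.split)

lemma block_matrix_identity:
  "mat 1 = block_matrix (mat 1) 0 0 (mat 1)"
  by (auto simp: vec_eq_iff row_block_def col_block_def block_matrix_def mat_def split: sum.split)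

lemma block_matrix_diff:
  fixes X11 :: "'a::ab_group_add^'m^'r"
  shows "block_matrix X11 X12 X21 X22 - block_matrix Y11 Y12 Y21 Y22
    = block_matrix (X11 - Y11) (X12 - Y12) (X21 - Y21) (X22 - Y22)"
  by (auto simp: vec_eq_iff row_block_def col_block_def block_matrix_def split: sum.split)

lemma transpose_zero: "transpose 0 = 0"
  by (simp add: vec_eq_iff transpose_def)

lemma col_block_zero: "col_block 0 0 = 0"
  by (auto simp: vec_eq_iff col_block_def split: sum.split)

lemma row_block_zero: "row_block 0 0 = 0"
  by (auto simp: vec_eq_iff row_block_def split: sum.split)

section \<open>Symmetric positive definite matrices\<close>

lemma sym_pos_def_sym: "sym_pos_def K \<Longrightarrow> transpose K = K"
  by (simp add: sym_pos_def_def)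

lemma sym_pos_def_pos: "sym_pos_def K \<Longrightarrow> v \<noteq> 0 \<Longrightarrow> 0 < v \<bullet> (K *v v)"
  by (simp add: sym_pos_def_def)

lemma sym_pos_def_nonneg: "sym_pos_def K \<Longrightarrow> 0 \<le> v \<bullet> (K *v v)"
  by (cases "v = 0") (auto dest: sym_pos_def_pos less_imp_le)

lemma inner_matrix_transpose:
  fixes K :: "real^'n^'m"
  shows "x \<bullet> (K *v y) = (transpose K *v x) \<bullet> y"
  by (metis dot_lmul_matrix transpose_matrix_vector)

lemma sym_pos_def_commute:
  assumes "sym_pos_def K" shows "x \<bullet> (K *v y) = y \<bullet> (K *v x)"
  by (metis assms inner_commute inner_matrix_transpose sym_pos_def_sym)

lemma pos_imp_invertible:
  fixes K :: "real^'n^'n"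
  assumes "\<And>v. v \<noteq> 0 \<Longrightarrow> 0 < v \<bullet> (K *v v)"
  shows "invertible K"
proof -
  have "\<forall>x. K *v x = 0 \<longrightarrow> x = 0"
    using assms by force
  then show ?thesis
    by (metis invertible_left_inverse matrix_left_invertible_ker)
qed

lemma sym_pos_def_invertible: "sym_pos_def K \<Longrightarrow> invertible K"
  by (auto intro: pos_imp_invertible sym_pos_def_pos)

lemma matrix_inv_inverse:
  fixes K :: "real^'n^'n"
  assumes "invertible K"
  shows "K ** matrix_inv K = mat 1" "matrix_inv K ** K = mat 1"
proof -
  have "K ** matrix_inv K = mat 1 \<and> matrix_inv K ** K = mat 1"
    using assms unfolding invertible_def matrix_inv_def by (rule someI_ex)
  then show "K ** matrix_inv K = mat 1" "matrix_inv K ** K = mat 1"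
    by simp_all
qed

lemma matrix_inv_vec:
  fixes K :: "real^'n^'n"
  assumes "invertible K"
  shows "K *v (matrix_inv K *v y) = y" "matrix_inv K *v (K *v y) = y"
  using assms by (simp_all add: matrix_vector_mul_assoc matrix_inv_inverse)

lemma sym_pos_def_congruence:
  fixes Q :: "real^'m^'n"
  assumes K: "sym_pos_def K" and inj: "\<And>v. Q *v v = 0 \<Longrightarrow> v = 0"
  shows "sym_pos_def (transpose Q ** K ** Q)"
  unfolding sym_pos_def_def
proof (intro conjI allI impI)
  show "transpose (transpose Q ** K ** Q) = transpose Q ** K ** Q"
    using sym_pos_def_sym[OF K] by (simp add: matrix_transpose_mul matrix_mul_assoc)
  fix v :: "real^'m" assume "v \<noteq> 0"
  then have "0 < (Q *v v) \<bullet> (K *v (Q *v v))"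
    using sym_pos_def_pos[OF K] inj by blast
  also have "\<dots> = v \<bullet> ((transpose Q ** K ** Q) *v v)"
    by (simp add: inner_matrix_transpose[of v "transpose Q"] matrix_vector_mul_assoc[symmetric]
        del: transpose_matrix_vector)
  finally show "0 < v \<bullet> ((transpose Q ** K ** Q) *v v)" .
qed

lemma congruence_add:
  fixes X Y :: "real^'n^'n" and Q :: "real^'m^'n"
  shows "transpose Q ** (X + Y) ** Q = transpose Q ** X ** Q + transpose Q ** Y ** Q"
  by (simp add: vec_eq_iff matrix_matrix_mult_def distrib_left distrib_right sum.distrib)

lemma congruence_diff:
  fixes X Y :: "real^'n^'n" and Q :: "real^'m^'n"
  shows "transpose Q ** (X - Y) ** Q = transpose Q ** X ** Q - transpose Q ** Y ** Q"
  by (simp add: vec_eq_iff matrix_matrix_mult_def left_diff_distrib right_diff_distrib sum_subtractf)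

lemma sym_pos_def_inverse:
  assumes K: "sym_pos_def K"
  shows "sym_pos_def (matrix_inv K)"
proof -
  let ?L = "matrix_inv K"
  have inv: "invertible K" using K by (rule sym_pos_def_invertible)
  have "transpose ?L ** K = mat 1"
    using matrix_inv_inverse(1)[OF inv] sym_pos_def_sym[OF K] by (metis matrix_transpose_mul transpose_mat)
  then have "transpose ?L ** K ** ?L = ?L"
    by simp
  moreover have "sym_pos_def (transpose ?L ** K ** ?L)"
    using K by (rule sym_pos_def_congruence) (metis inv matrix_inv_vec(1) matrix_vector_mult_0_right)
  ultimately show ?thesis by simp
qed

lemma energy_Cauchy_Schwarz:
  assumes K: "sym_pos_def K"
  shows "(x \<bullet> (K *v y))\<^sup>2 \<le> (x \<bullet> (K *v x)) * (y \<bullet> (K *v y))"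
proof (cases "y = 0")
  case False
  define a b c where "a = x \<bullet> (K *v x)" and "b = x \<bullet> (K *v y)" and "c = y \<bullet> (K *v y)"
  have c: "c > 0" using sym_pos_def_pos[OF K False] by (simp add: c_def)
  have "0 \<le> (c *\<^sub>R x - b *\<^sub>R y) \<bullet> (K *v (c *\<^sub>R x - b *\<^sub>R y))"
    by (rule sym_pos_def_nonneg[OF K])
  also have "\<dots> = c * (a * c - b\<^sup>2)"
    using sym_pos_def_commute[OF K, of y x]
    by (simp add: matrix_vector_mult_diff_distrib matrix_vector_mult_scaleR inner_diff_left
        inner_diff_right a_def b_def c_def algebra_simps power2_eq_square)
  finally have "b\<^sup>2 \<le> a * c" using c by (simp add: zero_le_mult_iff)
  then show ?thesis by (simp add: a_def b_def c_def)
qed simp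

lemma norm_matrix_vector_le_onorm:
  fixes B :: "real^'n^'m"
  shows "norm (B *v v) \<le> onorm ((*v) B) * norm v"
  by (rule onorm[OF matrix_vector_mul_bounded_linear])

lemma onorm_matrix_nonneg:
  fixes B :: "real^'n^'m"
  shows "0 \<le> onorm ((*v) B)"
  by (rule onorm_pos_le[OF matrix_vector_mul_bounded_linear])

lemma inner_matrix_le_onorm:
  fixes B :: "real^'n^'n"
  shows "v \<bullet> (B *v v) \<le> onorm ((*v) B) * (norm v)\<^sup>2"
proof -
  have "v \<bullet> (B *v v) \<le> norm v * norm (B *v v)"
    by (rule norm_cauchy_schwarz)
  also have "\<dots> \<le> norm v * (onorm ((*v) B) * norm v)"
    by (intro mult_left_mono norm_matrix_vector_le_onorm) simp
  finally show ?thesis by (simp add: power2_eq_square mult_ac)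
qed

text \<open>
  This is the Cauchy--Schwarz inequality in the \<open>K\<close>-form for the pair \<open>K v\<close>, \<open>v\<close>. It takes the place
  of an eigenvector expansion in passing from the quadratic form of \<open>K\<close> to the norm of \<open>K\<close>.
\<close>

lemma sym_pos_def_norm_sq_le:
  assumes K: "sym_pos_def K" and c: "\<And>v. v \<bullet> (K *v v) \<le> c * (norm v)\<^sup>2"
  shows "(norm (K *v v))\<^sup>2 \<le> c * (v \<bullet> (K *v v))"
proof (cases "K *v v = 0")
  case False
  let ?x = "K *v v"
  have "((norm ?x)\<^sup>2)\<^sup>2 \<le> (?x \<bullet> (K *v ?x)) * (v \<bullet> (K *v v))"
    using energy_Cauchy_Schwarz[OF K, of ?x v] by (simp add: power2_norm_eq_inner)
  also have "\<dots> \<le> (c * (norm ?x)\<^sup>2) * (v \<bullet> (K *v v))"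
    by (intro mult_right_mono c sym_pos_def_nonneg[OF K])
  finally have "(norm ?x)\<^sup>2 * (norm ?x)\<^sup>2 \<le> (norm ?x)\<^sup>2 * (c * (v \<bullet> (K *v v)))"
    by (simp only: power2_eq_square mult_ac)
  then show ?thesis
    by (rule mult_left_le_imp_le) (simp add: False)
qed simp

lemma sym_pos_def_onorm_le:
  assumes K: "sym_pos_def K" and c: "\<And>v. v \<bullet> (K *v v) \<le> c * (norm v)\<^sup>2" and "0 \<le> c"
  shows "onorm ((*v) K) \<le> c"
proof (rule onorm_bound[OF \<open>0 \<le> c\<close>])
  fix v
  have "(norm (K *v v))\<^sup>2 \<le> c * (v \<bullet> (K *v v))"
    by (rule sym_pos_def_norm_sq_le[OF K c])
  also have "\<dots> \<le> c * (c * (norm v)\<^sup>2)"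
    by (intro mult_left_mono c \<open>0 \<le> c\<close>)
  also have "\<dots> = (c * norm v)\<^sup>2"
    by (simp add: power2_eq_square)
  finally show "norm (K *v v) \<le> c * norm v"
    by (rule power2_le_imp_le) (simp add: \<open>0 \<le> c\<close>)
qed

text \<open>
  Write \<open>v = K\<^sup>-\<^sup>1 (K v)\<close> and bound \<open>K v\<close> by the energy of \<open>v\<close>. The constant is far from optimal; only
  its existence matters, for the finiteness of the supremum in the energy operator norm.
\<close>

lemma sym_pos_def_coercive:
  assumes K: "sym_pos_def K"
  shows "(norm v)\<^sup>2 \<le> (onorm ((*v) (matrix_inv K)))\<^sup>2 * onorm ((*v) K) * (v \<bullet> (K *v v))"
proof -
  let ?L = "matrix_inv K"
  have "norm v \<le> onorm ((*v) ?L) * norm (K *v v)"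
    using norm_matrix_vector_le_onorm[of ?L "K *v v"] matrix_inv_vec(2)[OF sym_pos_def_invertible[OF K]]
    by simp
  then have "(norm v)\<^sup>2 \<le> (onorm ((*v) ?L))\<^sup>2 * (norm (K *v v))\<^sup>2"
    by (metis norm_ge_zero power_mono power_mult_distrib)
  also have "\<dots> \<le> (onorm ((*v) ?L))\<^sup>2 * (onorm ((*v) K) * (v \<bullet> (K *v v)))"
    by (intro mult_left_mono sym_pos_def_norm_sq_le[OF K] inner_matrix_le_onorm) simp
  finally show ?thesis by (simp add: mult_ac)
qed

section \<open>The energy operator norm\<close>

text \<open>
  An unbounded supremum of reals has an arbitrary value, so boundedness is what ties
  \<open>energy_onorm\<close> to an estimate for individual vectors.
\<close>

lemma energy_onorm_bdd_above:
  assumes K: "sym_pos_def K"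
  shows "bdd_above (range (\<lambda>v. energy_norm K (B *v v) / energy_norm K v))"
proof -
  define c where "c = onorm ((*v) K) * (onorm ((*v) B))\<^sup>2
      * ((onorm ((*v) (matrix_inv K)))\<^sup>2 * onorm ((*v) K))"
  have "energy_norm K (B *v v) / energy_norm K v \<le> sqrt c" for v
  proof (cases "v = 0")
    case False
    have "(B *v v) \<bullet> (K *v (B *v v)) \<le> onorm ((*v) K) * (norm (B *v v))\<^sup>2"
      by (rule inner_matrix_le_onorm)
    also have "\<dots> \<le> onorm ((*v) K) * (onorm ((*v) B) * norm v)\<^sup>2"
      by (intro mult_left_mono power_mono norm_matrix_vector_le_onorm onorm_matrix_nonneg) simp
    also have "\<dots> = onorm ((*v) K) * (onorm ((*v) B))\<^sup>2 * (norm v)\<^sup>2"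
      by (simp add: power_mult_distrib mult_ac)
    also have "\<dots> \<le> onorm ((*v) K) * (onorm ((*v) B))\<^sup>2
        * ((onorm ((*v) (matrix_inv K)))\<^sup>2 * onorm ((*v) K) * (v \<bullet> (K *v v)))"
      by (intro mult_left_mono sym_pos_def_coercive[OF K] mult_nonneg_nonneg
          onorm_matrix_nonneg zero_le_power2)
    also have "\<dots> = c * (v \<bullet> (K *v v))"
      by (simp add: c_def mult_ac)
    finally have "energy_norm K (B *v v) \<le> sqrt c * energy_norm K v"
      unfolding energy_norm_def real_sqrt_mult[symmetric] by (rule real_sqrt_le_mono)
    then show ?thesis
      using sym_pos_def_pos[OF K False] by (simp add: energy_norm_def divide_simps)
  qed (simp add: energy_norm_def c_def onorm_matrix_nonneg)
  then show ?thesis by (auto intro!: bdd_aboveI)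
qed

lemma energy_onorm_bound:
  assumes K: "sym_pos_def K"
  shows "energy_norm K (B *v v) \<le> energy_onorm K B * energy_norm K v"
proof (cases "v = 0")
  case False
  have "energy_norm K (B *v v) / energy_norm K v \<le> energy_onorm K B"
    unfolding energy_onorm_def by (rule cSUP_upper[OF UNIV_I energy_onorm_bdd_above[OF K]])
  then show ?thesis
    using sym_pos_def_pos[OF K False] by (simp add: energy_norm_def divide_simps)
qed (simp add: energy_norm_def)

lemma energy_onorm_nonneg:
  assumes K: "sym_pos_def K"
  shows "0 \<le> energy_onorm K B"
  unfolding energy_onorm_def
  by (rule cSUP_upper2[OF energy_onorm_bdd_above[OF K] UNIV_I[of 0]]) (simp add: energy_norm_def)

section \<open>Spectral comparison of a matrix and its smoother\<close>

text \<open>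
  The error propagator maps \<open>w\<close> to \<open>w - M\<^sup>-\<^sup>1 K w\<close>. Naming \<open>v = M\<^sup>-\<^sup>1 K w\<close> by the equation
  \<open>M v = K w\<close> allows the estimate to be started from a given \<open>v\<close> as well as from a given \<open>w\<close>.
\<close>

lemma smoother_energy_contraction:
  fixes K M :: "real^'n^'n"
  assumes K: "sym_pos_def K" and M: "invertible M"
    and \<rho>: "energy_onorm K (mat 1 - matrix_inv M ** K) \<le> \<delta>"
    and eq: "M *v v = K *v w"
  shows "(w - v) \<bullet> (K *v (w - v)) \<le> \<delta>\<^sup>2 * (w \<bullet> (K *v w))"
proof -
  have E: "(mat 1 - matrix_inv M ** K) *v w = w - v"
    using matrix_inv_vec(2)[OF M, of v]
    by (simp add: matrix_vector_mult_diff_rdistrib matrix_vector_mul_assoc[symmetric] eq)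
  have "energy_norm K (w - v) \<le> energy_onorm K (mat 1 - matrix_inv M ** K) * energy_norm K w"
    using energy_onorm_bound[OF K, of "mat 1 - matrix_inv M ** K" w] by (simp add: E)
  also have "\<dots> \<le> \<delta> * energy_norm K w"
    by (intro mult_right_mono \<rho>) (simp add: energy_norm_def sym_pos_def_nonneg[OF K])
  finally have "(energy_norm K (w - v))\<^sup>2 \<le> (\<delta> * energy_norm K w)\<^sup>2"
    by (intro power_mono) (simp_all add: energy_norm_def sym_pos_def_nonneg[OF K])
  then show ?thesis
    by (simp add: energy_norm_def power_mult_distrib sym_pos_def_nonneg[OF K])
qed

lemma energy_expand_diff:
  assumes K: "sym_pos_def K"
  shows "(w - v) \<bullet> (K *v (w - v)) = w \<bullet> (K *v w) - 2 * (v \<bullet> (K *v w)) + v \<bullet> (K *v v)"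
  using sym_pos_def_commute[OF K, of w v]
  by (simp add: matrix_vector_mult_diff_distrib inner_diff_left inner_diff_right)

text \<open>
  With \<open>K w = M v\<close>, the form \<open>v\<^sup>T M v\<close> is the energy inner product of \<open>v\<close> and \<open>w\<close>. Bounding it by
  the contraction estimate and the triangle inequality separately would lose a factor; expanding
  the square of the energy norm of \<open>w - v\<close> first, and only then bounding \<open>w\<close> below in terms of
  \<open>v\<close>, gives the sharp constant \<open>1 + \<delta>\<close>.
\<close>

lemma smoother_lower_bound:
  fixes K M :: "real^'n^'n"
  assumes K: "sym_pos_def K" and M: "invertible M"
    and \<rho>: "energy_onorm K (mat 1 - matrix_inv M ** K) \<le> \<delta>" and \<delta>: "\<delta> < 1"
  shows "v \<bullet> (K *v v) \<le> (1 + \<delta>) * (v \<bullet> (M *v v))"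
proof -
  have \<delta>0: "0 \<le> \<delta>" using energy_onorm_nonneg[OF K] \<rho> by (rule order_trans)
  define w where "w = matrix_inv K *v (M *v v)"
  have eq: "M *v v = K *v w"
    by (simp add: w_def matrix_inv_vec[OF sym_pos_def_invertible[OF K]])
  define a b c where "a = w \<bullet> (K *v w)" and "b = v \<bullet> (K *v w)" and "c = v \<bullet> (K *v v)"
  have nonneg: "0 \<le> a" "0 \<le> c"
    by (simp_all add: a_def c_def sym_pos_def_nonneg[OF K])
  have 1: "a - 2 * b + c \<le> \<delta>\<^sup>2 * a"
    using smoother_energy_contraction[OF K M \<rho> eq] by (simp add: energy_expand_diff[OF K] a_def b_def c_def)
  have 2: "b\<^sup>2 \<le> c * a"
    using energy_Cauchy_Schwarz[OF K, of v w] by (simp add: a_def b_def c_def)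
  \<comment> \<open>Triangle inequality: \<open>v\<close> is at most \<open>1 + \<delta>\<close> times as long as \<open>w\<close>.\<close>
  have "b \<le> sqrt c * sqrt a"
    using real_sqrt_le_mono[OF 2] nonneg by (simp add: real_sqrt_mult)
  then have "(sqrt c - sqrt a)\<^sup>2 \<le> (\<delta> * sqrt a)\<^sup>2"
    using 1 nonneg by (simp add: power2_diff power_mult_distrib)
  then have "sqrt c - sqrt a \<le> \<delta> * sqrt a"
    by (rule power2_le_imp_le) (simp add: \<delta>0 nonneg)
  then have "(sqrt c)\<^sup>2 \<le> ((1 + \<delta>) * sqrt a)\<^sup>2"
    by (intro power_mono) (simp_all add: algebra_simps nonneg)
  then have "c \<le> (1 + \<delta>)\<^sup>2 * a"
    using nonneg by (simp add: power_mult_distrib)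
  then have "(1 - \<delta>) * c \<le> (1 - \<delta>) * ((1 + \<delta>)\<^sup>2 * a)"
    using \<delta> by (intro mult_left_mono) simp_all
  moreover have "(1 + \<delta>) * (a - 2 * b + c) \<le> (1 + \<delta>) * (\<delta>\<^sup>2 * a)"
    using 1 \<delta>0 by (intro mult_left_mono) simp_all
  \<comment> \<open>Adding the two estimates cancels \<open>a\<close>, because \<open>(1 - \<delta>) (1 + \<delta>)\<^sup>2 = (1 + \<delta>) (1 - \<delta>\<^sup>2)\<close>.\<close>
  ultimately have "c \<le> (1 + \<delta>) * b"
    by (simp add: power2_eq_square algebra_simps)
  then show ?thesis by (simp add: b_def c_def eq)
qed

text \<open>
  With \<open>w = K\<^sup>-\<^sup>1 y\<close> and \<open>v = M\<^sup>-\<^sup>1 y\<close>, both sides are energy inner products of \<open>w\<close>, with \<open>w\<close> and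
  with \<open>v\<close>; Cauchy--Schwarz bounds the inner product of \<open>w\<close> with \<open>w - v\<close>.
\<close>

lemma smoother_inverse_bound:
  fixes K M :: "real^'n^'n"
  assumes K: "sym_pos_def K" and M: "invertible M"
    and \<rho>: "energy_onorm K (mat 1 - matrix_inv M ** K) \<le> \<delta>"
  shows "(1 - \<delta>) * (y \<bullet> (matrix_inv K *v y)) \<le> y \<bullet> (matrix_inv M *v y)"
proof -
  have \<delta>0: "0 \<le> \<delta>" using energy_onorm_nonneg[OF K] \<rho> by (rule order_trans)
  define w v where "w = matrix_inv K *v y" and "v = matrix_inv M *v y"
  have y: "y = K *v w" "M *v v = K *v w"
    by (simp_all add: w_def v_def matrix_inv_vec[OF sym_pos_def_invertible[OF K]] matrix_inv_vec[OF M])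
  let ?q = "\<lambda>x. x \<bullet> (K *v x)"
  have "(w \<bullet> (K *v (w - v)))\<^sup>2 \<le> ?q w * ?q (w - v)"
    by (rule energy_Cauchy_Schwarz[OF K])
  also have "\<dots> \<le> ?q w * (\<delta>\<^sup>2 * ?q w)"
    by (intro mult_left_mono smoother_energy_contraction[OF K M \<rho> y(2)] sym_pos_def_nonneg[OF K])
  also have "\<dots> = (\<delta> * ?q w)\<^sup>2"
    by (simp add: power2_eq_square)
  finally have "w \<bullet> (K *v (w - v)) \<le> \<delta> * ?q w"
    by (rule power2_le_imp_le) (simp add: \<delta>0 sym_pos_def_nonneg[OF K])
  then have "(1 - \<delta>) * ?q w \<le> w \<bullet> (K *v v)"
    by (simp add: matrix_vector_mult_diff_distrib inner_diff_right algebra_simps)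
  also have "\<dots> = y \<bullet> v"
    using sym_pos_def_commute[OF K, of w v] by (simp add: y(1) inner_commute)
  finally show ?thesis
    by (simp add: y(1)[symmetric] inner_commute flip: w_def v_def)
qed

lemma cond_number_smoother_bound:
  fixes K M :: "real^'n^'n"
  assumes K: "sym_pos_def K" and M: "invertible M"
    and \<rho>: "energy_onorm K (mat 1 - matrix_inv M ** K) \<le> \<delta>" and \<delta>: "\<delta> < 1"
  shows "cond_number K \<le> cond_number M * ((1 + \<delta>) / (1 - \<delta>))"
proof -
  let ?n = "\<lambda>B :: real^'n^'n. onorm ((*v) B)"
  have \<delta>0: "0 \<le> \<delta>" using energy_onorm_nonneg[OF K] \<rho> by (rule order_trans)
  have upper: "?n K \<le> (1 + \<delta>) * ?n M"
  proof (rule sym_pos_def_onorm_le[OF K])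
    fix v
    have "(1 + \<delta>) * (v \<bullet> (M *v v)) \<le> (1 + \<delta>) * (?n M * (norm v)\<^sup>2)"
      using \<delta>0 by (intro mult_left_mono inner_matrix_le_onorm) simp
    then show "v \<bullet> (K *v v) \<le> (1 + \<delta>) * ?n M * (norm v)\<^sup>2"
      using smoother_lower_bound[OF assms, of v] by (simp add: mult.assoc)
  qed (use \<delta>0 in \<open>simp add: onorm_matrix_nonneg\<close>)
  have lower: "?n (matrix_inv K) \<le> ?n (matrix_inv M) / (1 - \<delta>)"
  proof (rule sym_pos_def_onorm_le[OF sym_pos_def_inverse[OF K]])
    fix y
    have "(1 - \<delta>) * (y \<bullet> (matrix_inv K *v y)) \<le> ?n (matrix_inv M) * (norm y)\<^sup>2"
      using smoother_inverse_bound[OF K M \<rho>, of y] inner_matrix_le_onorm[of y "matrix_inv M"]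
      by simp
    then show "y \<bullet> (matrix_inv K *v y) \<le> ?n (matrix_inv M) / (1 - \<delta>) * (norm y)\<^sup>2"
      using \<delta> by (simp add: field_simps)
  qed (use \<delta> in \<open>simp add: onorm_matrix_nonneg\<close>)
  have "?n K * ?n (matrix_inv K) \<le> ((1 + \<delta>) * ?n M) * (?n (matrix_inv M) / (1 - \<delta>))"
    using upper lower \<delta>0 by (intro mult_mono) (simp_all add: onorm_matrix_nonneg)
  then show ?thesis
    by (simp add: cond_number_def mult_ac)
qed

text \<open>
  The skew part of \<open>M\<close> does not contribute to \<open>v\<^sup>T M v\<close>, which for \<open>v \<noteq> 0\<close> is therefore
  more than half of \<open>v\<^sup>T K v\<close>; a matrix with positive quadratic form has trivial kernel.
\<close>

lemma smoother_invertible: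
  fixes K M :: "real^'n^'n"
  assumes K: "sym_pos_def K" and MK: "sym_pos_def (M + transpose M - K)"
  shows "invertible M"
proof (rule pos_imp_invertible)
  fix v :: "real^'n" assume v: "v \<noteq> 0"
  have "v \<bullet> (transpose M *v v) = v \<bullet> (M *v v)"
    by (simp add: inner_matrix_transpose[of v M] inner_commute)
  then show "0 < v \<bullet> (M *v v)"
    using sym_pos_def_pos[OF K v] sym_pos_def_pos[OF MK v]
    by (simp add: matrix_vector_mult_diff_rdistrib matrix_vector_mult_add_rdistrib
        inner_diff_right inner_add_right)
qed

section \<open>Ideal interpolation and the conditioning of the first block\<close>

theorem mainTheorem6:
  fixes A :: "real^('f::finite + 'c::finite)^('f + 'c)"
    and Aff :: "real^'f^'f" and Afc :: "real^'c^'f"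
    and Acf :: "real^'f^'c" and Acc :: "real^'c^'c"
    and R :: "real^('f + 'c)^'c" and S :: "real^'f^('f + 'c)"
    and P :: "real^'c^('f + 'c)" and W :: "real^'c^'f"
  assumes A_blocks: "A = block_matrix Aff Afc Acf Acc"
    and A_spd: "sym_pos_def A"
    and R_def: "R = row_block 0 (mat 1)"
    and S_def: "S = col_block (mat 1) 0"
    and P_def: "P = col_block W (mat 1)"
    and W_def: "W = - (matrix_inv Aff ** Afc)"
  shows "mat 1 - A_projection A P
           = mat 1 - P ** matrix_inv (transpose P ** A ** P) ** transpose P ** A
       \<and> mat 1 - P ** matrix_inv (transpose P ** A ** P) ** transpose P ** A
           = S ** matrix_inv (transpose S ** A ** S) ** transpose S ** A
       \<and> S ** matrix_inv (transpose S ** A ** S) ** transpose S ** A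
           = block_matrix (mat 1) (- W) 0 0
       \<and> (\<forall>(M :: real^('f + 'c)^('f + 'c)) (Mff :: real^'f^'f) (\<rho> :: real) (\<delta> :: real).
            sym_pos_def (M + transpose M - A) \<longrightarrow>
            Mff = transpose S ** M ** S \<longrightarrow>
            \<rho> = energy_onorm Aff (mat 1 - matrix_inv Mff ** Aff) \<longrightarrow>
            \<rho> \<le> \<delta> \<longrightarrow> \<delta> < 1 \<longrightarrow>
            cond_number Aff \<le> cond_number Mff * ((1 + \<delta>) / (1 - \<delta>)))"
proof (intro conjI allI impI)
  \<comment> \<open>Left inverses of \<open>P\<close> and \<open>S\<close> give the injectivity that carries positive definiteness over
    to \<open>P\<^sup>T A P\<close>, \<open>S\<^sup>T A S\<close> and \<open>S\<^sup>T (M + M\<^sup>T - A) S\<close>.\<close>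
  have RP: "row_block 0 (mat 1) ** P = mat 1"
    by (simp add: P_def row_block_mult_col_block)
  have StS: "transpose S ** S = mat 1"
    by (simp add: S_def transpose_col_block row_block_mult_col_block transpose_zero)
  have S_inj: "v = 0" if "S *v v = 0" for v
    using that StS by (metis matrix_vector_mul_assoc matrix_vector_mul_lid matrix_vector_mult_0_right)
  have P_inj: "v = 0" if "P *v v = 0" for v
    using that RP by (metis matrix_vector_mul_assoc matrix_vector_mul_lid matrix_vector_mult_0_right)
  have StA: "transpose S ** A = row_block Aff Afc"
    by (simp add: S_def A_blocks block_matrix_def transpose_col_block row_block_mult_col_block transpose_zero)
  have StAS: "transpose S ** A ** S = Aff"
    by (simp add: StA) (simp add: S_def row_block_mult_col_block)
  have Aff: "sym_pos_def Aff"
    using sym_pos_def_congruence[OF A_spd, of S] S_inj by (simp add: StAS)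
  have AffW: "Aff ** W + Afc = 0"
  proof -
    have "Aff ** W = - (Aff ** (matrix_inv Aff ** Afc))"
      by (simp add: W_def vec_eq_iff matrix_matrix_mult_def sum_negf)
    then show ?thesis
      by (simp add: matrix_mul_assoc matrix_inv_inverse(1)[OF sym_pos_def_invertible[OF Aff]])
  qed
  define \<Sigma> where "\<Sigma> = transpose P ** A ** P"
  have AP: "A ** P = col_block 0 (Acf ** W + Acc)"
    by (simp add: P_def A_blocks block_matrix_def col_block_mult row_block_mult_col_block AffW)
  have \<Sigma>: "\<Sigma> = Acf ** W + Acc"
    by (simp add: \<Sigma>_def AP matrix_mul_assoc[symmetric])
      (simp add: P_def transpose_col_block row_block_mult_col_block transpose_zero)
  have \<Sigma>_spd: "sym_pos_def \<Sigma>"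
    unfolding \<Sigma>_def using A_spd P_inj by (rule sym_pos_def_congruence)
  have PtA: "transpose P ** A = row_block 0 \<Sigma>"
  proof -
    have "transpose P ** A = transpose (A ** P)"
      by (simp add: matrix_transpose_mul sym_pos_def_sym[OF A_spd])
    also have "\<dots> = row_block 0 (transpose \<Sigma>)"
      by (simp add: AP \<Sigma> transpose_col_block transpose_zero)
    finally show ?thesis by (simp add: sym_pos_def_sym[OF \<Sigma>_spd])
  qed
  have "P ** matrix_inv \<Sigma> ** transpose P ** A = P ** (matrix_inv \<Sigma> ** (transpose P ** A))"
    by (simp add: matrix_mul_assoc)
  also have "\<dots> = P ** row_block 0 (mat 1)"
    by (simp add: PtA mult_row_block matrix_inv_inverse(2)[OF sym_pos_def_invertible[OF \<Sigma>_spd]])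
  also have "\<dots> = block_matrix 0 W 0 (mat 1)"
    by (simp add: P_def mult_row_block col_block_mult col_block_zero
        flip: row_block_col_block)
  finally have proj_P: "mat 1 - P ** matrix_inv \<Sigma> ** transpose P ** A = block_matrix (mat 1) (- W) 0 0"
    by (simp add: block_matrix_identity block_matrix_diff)
  have "S ** matrix_inv Aff ** transpose S ** A = S ** (matrix_inv Aff ** (transpose S ** A))"
    by (simp add: matrix_mul_assoc)
  also have "\<dots> = S ** row_block (mat 1) (- W)"
    by (simp add: StA mult_row_block W_def matrix_inv_inverse(2)[OF sym_pos_def_invertible[OF Aff]])
  also have "\<dots> = block_matrix (mat 1) (- W) 0 0"
    by (simp add: S_def block_matrix_def col_block_mult row_block_zero)
  finally have proj_S: "S ** matrix_inv Aff ** transpose S ** A = block_matrix (mat 1) (- W) 0 0" .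
  show "mat 1 - A_projection A P
      = mat 1 - P ** matrix_inv (transpose P ** A ** P) ** transpose P ** A"
    by (simp add: A_projection_def)
  show "mat 1 - P ** matrix_inv (transpose P ** A ** P) ** transpose P ** A
      = S ** matrix_inv (transpose S ** A ** S) ** transpose S ** A"
    using proj_P proj_S unfolding StAS \<Sigma>_def by simp
  show "S ** matrix_inv (transpose S ** A ** S) ** transpose S ** A
      = block_matrix (mat 1) (- W) 0 0"
    using proj_S unfolding StAS .
  fix M :: "real^('f + 'c)^('f + 'c)" and Mff :: "real^'f^'f" and \<rho> \<delta> :: real
  assume M: "sym_pos_def (M + transpose M - A)" and Mff: "Mff = transpose S ** M ** S"
    and \<rho>: "\<rho> = energy_onorm Aff (mat 1 - matrix_inv Mff ** Aff)" "\<rho> \<le> \<delta>" and \<delta>: "\<delta> < 1"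
  have "transpose S ** (M + transpose M - A) ** S = Mff + transpose Mff - Aff"
    by (simp add: Mff StAS[symmetric] matrix_transpose_mul congruence_add congruence_diff
        matrix_mul_assoc)
  then have "sym_pos_def (Mff + transpose Mff - Aff)"
    using sym_pos_def_congruence[OF M, of S] S_inj by simp
  then have "invertible Mff"
    by (rule smoother_invertible[OF Aff])
  then show "cond_number Aff \<le> cond_number Mff * ((1 + \<delta>) / (1 - \<delta>))"
    using cond_number_smoother_bound[OF Aff _ _ \<delta>] \<rho> by simp
qed

end
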